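(* There is a universal constant $C<\infty$ such that, for the multisecretary problem with candidate-ability distribution $F_0=\mathrm{Uniform}([0,1/4]\cup[3/4,1])$, for all $T\in\mathbb N$ and all $B\in[T]$, $$\mathrm{Regret}(B,T;\mathrm{CwG})\le C(\log T)^2.$$
   Context: Multisecretary problem: horizon $T\in\mathbb N$, hiring budget $B\in[T]=\{1,\dots,T\}$. Abilities $\theta_1,\dots,\theta_T\in[0,1]$ are i.i.d. from a known distribution with CDF $F$. At each time $t$, after observing $\theta_t$, the decision maker irrevocably accepts ($a_t=1$) or rejects ($a_t=0$); at most $B$ acceptances in total; policies may be randomized and must be non-anticipating. $\mathrm{Regret}(B,T;\pi)=\mathbb E\big[\max\{\sum_t\theta_t a_t:a\in\{0,1\}^T,\sum_t a_t\le B\}\big]-\mathbb E[\sum_t\theta_t a_t^\pi]$. CwG policy for a distribution with CDF $F$, gap quantiles $q_1^\star<\dots<q_n^\star$ in $(0,1)$ and minimum cluster size $\varepsilon_0$: for $F=F_0$ take $n=1$, $q_1^\star=1/2$ (gap $(1/4,3/4)$) and $\varepsilon_0=1/2$. Let $F^{-1}(q)=\inf\{v:F(v)\ge q\}$. Set $B_1=B$ and $\tilde T=\max\{0,T-\lfloor 64\log(1/\varepsilon_0)/\varepsilon_0^2\rfloor\}$. Phase 1, $t=1,\dots,\tilde T$: let $p_t^{CE}=1-\frac{B_t}{T-t+1}$ and $\mathcal S_t=\{i:|p_t^{CE}-q_i^\star|\le\sqrt{2\log(T-t+1)/(T-t+1)}\}$. If $\mathcal S_t=\emptyset$ set $p_t^{CwG}=p_t^{CE}$;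 otherwise set $p_t^{CwG}=q_j^\star$ with $j\in\arg\min_{i\in\mathcal S_t}|p_t^{CE}-q_i^\star|$. Observe $\theta_t$, and draw $X_t$ uniformly at random from $\mathcal I_t=\{q\in[0,1]:F^{-1}(q)=\theta_t\}$ (its unique element if a singleton). If $X_t\ge p_t^{CwG}$ and $B_t>0$, accept and set $B_{t+1}=B_t-1$; otherwise reject and set $B_{t+1}=B_t$. Phase 2, $t=\tilde T+1,\dots,T$: same acceptance rule, with the fixed threshold $p_{\tilde T+1}^{CE}=1-\frac{B_{\tilde T+1}}{T-\tilde T}$ in place of $p_t^{CwG}$. *)

theory Defs
  imports "HOL-Probability.Probability"
begin

text \<open>
  Abilities and actions are indexed by the times \<open>1, \<dots>, T\<close>. Values of sequences outside this range
  are irrelevant.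
\<close>

definition hindsight :: "nat \<Rightarrow> nat \<Rightarrow> (nat \<Rightarrow> real) \<Rightarrow> real" where
  "hindsight B T \<theta> =
     Max {(\<Sum>t=1..T. \<theta> t * real (a t)) | a :: nat \<Rightarrow> nat.
            a \<in> {1..T} \<rightarrow>\<^sub>E {0, 1} \<and> (\<Sum>t=1..T. a t) \<le> B}"

text \<open>
  A randomized policy is evaluated on the abilities \<open>\<theta>\<close> and on a sequence \<open>u\<close> of independent
  uniform seeds that carries its internal randomness; \<open>\<pi> \<theta> u t \<in> {0, 1}\<close> is the action at time \<open>t\<close>.
  \<open>D\<close> is the law of a single ability.
\<close>

type_synonym policy = "(nat \<Rightarrow> real) \<Rightarrow> (nat \<Rightarrow> real) \<Rightarrow> nat \<Rightarrow> nat"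

definition admissible :: "nat \<Rightarrow> nat \<Rightarrow> policy \<Rightarrow> bool" where
  "admissible B T \<pi> \<longleftrightarrow>
     (\<forall>\<theta> u. (\<forall>t\<in>{1..T}. \<pi> \<theta> u t \<in> {0, 1}) \<and> (\<Sum>t=1..T. \<pi> \<theta> u t) \<le> B) \<and>
     (\<forall>\<theta> \<theta>' u u'. \<forall>t\<in>{1..T}.
        (\<forall>s\<in>{1..t}. \<theta> s = \<theta>' s \<and> u s = u' s) \<longrightarrow> \<pi> \<theta> u t = \<pi> \<theta>' u' t)"

definition sample_space :: "real measure \<Rightarrow> nat \<Rightarrow> (nat \<Rightarrow> real \<times> real) measure" where
  "sample_space D T = PiM {1..T} (\<lambda>_. D \<Otimes>\<^sub>M uniform_measure lborel {0..1})"

definition regret :: "real measure \<Rightarrow> nat \<Rightarrow> nat \<Rightarrow> policy \<Rightarrow> real" where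
  "regret D B T \<pi> =
     (\<integral>\<omega>. hindsight B T (\<lambda>t. fst (\<omega> t)) \<partial>sample_space D T) -
     (\<integral>\<omega>. (\<Sum>t=1..T. fst (\<omega> t) * real (\<pi> (\<lambda>t. fst (\<omega> t)) (\<lambda>t. snd (\<omega> t)) t))
        \<partial>sample_space D T)"

text \<open>Abilities live in \<open>[0, 1]\<close>, so the infimum is taken there; this only matters for \<open>q = 0\<close>.\<close>

definition quantile :: "(real \<Rightarrow> real) \<Rightarrow> real \<Rightarrow> real" where
  "quantile F q = Inf {v \<in> {0..1}. F v \<ge> q}"

definition quantile_set :: "(real \<Rightarrow> real) \<Rightarrow> real \<Rightarrow> real set" where
  "quantile_set F x = {q \<in> {0..1}. quantile F q = x}"

text \<open>
  A uniform draw from a bounded interval \<open>I\<close>, driven by a uniform seed \<open>u \<in> [0, 1]\<close>. For a singleton it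
  is the unique element.
\<close>

definition uniform_draw :: "real set \<Rightarrow> real \<Rightarrow> real" where
  "uniform_draw I u = Inf I + u * (Sup I - Inf I)"

lemma is_interval_quantile_set:
  assumes "F 1 = 1"
  shows "is_interval (quantile_set F x)"
proof -
  have mono: "quantile F p \<le> quantile F q" if "p \<le> q" "q \<le> 1" for p q
    unfolding quantile_def
  proof (rule cInf_superset_mono)
    show "{v \<in> {0..1}. q \<le> F v} \<noteq> {}" using assms that by (auto intro!: exI[of _ 1])
    show "bdd_below {v \<in> {0..1}. p \<le> F v}" by (rule bdd_belowI[of _ 0]) auto
    show "{v \<in> {0..1}. q \<le> F v} \<subseteq> {v \<in> {0..1}. p \<le> F v}" using that by auto
  qed
  show ?thesis
    unfolding is_interval_1 quantile_set_def
    by clarsimp (metis mono order_antisym order_trans)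
qed

lemma uniform_draw_singleton: "uniform_draw {q} u = q"
  by (simp add: uniform_draw_def)

lemma distr_uniform_draw:
  assumes I: "is_interval I" "bounded I" "I \<noteq> {}" "Inf I < Sup I"
  shows "distr (uniform_measure lborel {0..1}) borel (uniform_draw I) = uniform_measure lborel I"
proof -
  define a b where "a = Inf I" and "b = Sup I"
  have ab: "a < b" using I by (simp add: a_def b_def)
  have bdd: "bdd_below I" "bdd_above I"
    using I(2) by (auto intro: bounded_imp_bdd_below bounded_imp_bdd_above)
  have sub: "I \<subseteq> {a..b}" using bdd by (auto simp: a_def b_def cInf_lower cSup_upper)
  have sup: "x \<in> I" if x: "a < x" "x < b" for x
  proof -
    obtain y where "y \<in> I" "y < x" using x(1) I(3) bdd by (auto simp: a_def cInf_less_iff)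
    moreover obtain z where "z \<in> I" "x < z" using x(2) I(3) bdd by (auto simp: b_def less_cSup_iff)
    ultimately show ?thesis using I(1) unfolding is_interval_1 by (meson less_imp_le)
  qed
  have I_eq: "I = {a<..<b} \<union> (I \<inter> {a, b})" using sub sup by force
  have "I \<inter> {a, b} \<in> sets borel" by (intro borel_closed finite_imp_closed) simp
  then have [measurable]: "I \<in> sets borel"
    by (subst I_eq) (intro sets.Un; simp)
  define f where "f x = a + (b - a) * x" for x :: real
  have draw: "uniform_draw I = f" by (auto simp: uniform_draw_def f_def a_def b_def)
  have [measurable]: "f \<in> borel_measurable borel" by (simp add: f_def[abs_def])
  have null: "AE x in lborel. x \<noteq> 0 \<and> x \<noteq> (1::real)"
    by (intro AE_conjI AE_lborel_singleton)
  have pull: "emeasure lborel S = ennreal (b - a) * emeasure lborel (f -` S)"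
    if [measurable]: "S \<in> sets borel" for S
  proof -
    have "emeasure lborel S = emeasure (density (distr lborel borel f) (\<lambda>_. ennreal \<bar>b - a\<bar>)) S"
      using lborel_real_affine[of "b - a" a] ab by (simp add: f_def[abs_def])
    also have "\<dots> = ennreal (b - a) * emeasure (distr lborel borel f) S"
      using ab by (subst emeasure_density_const) auto
    finally show ?thesis by (simp add: emeasure_distr)
  qed
  have AEeq: "AE x in lborel. x \<in> f -` (I \<inter> A) \<longleftrightarrow> x \<in> {0..1} \<inter> f -` A" for A
    using null
  proof eventually_elim
    case (elim x)
    have "f x \<in> I \<longleftrightarrow> x \<in> {0..1}"
    proof
      assume "f x \<in> I"
      then have "f x \<in> {a..b}" using sub by auto
      then have "0 \<le> (b - a) * x" "(b - a) * x \<le> (b - a) * 1" by (auto simp: f_def)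
      then show "x \<in> {0..1}"
        using ab by (auto simp: zero_le_mult_iff mult_le_cancel_left)
    next
      assume "x \<in> {0..1}"
      then have "0 < x" "x < 1" using elim by auto
      then have "0 < (b - a) * x" "(b - a) * x < (b - a) * 1"
        using ab by (auto simp: mult_less_cancel_left)
      then show "f x \<in> I" by (intro sup) (auto simp: f_def)
    qed
    then show ?case by auto
  qed
  have main: "emeasure lborel (I \<inter> A) = ennreal (b - a) * emeasure lborel ({0..1} \<inter> f -` A)"
    if [measurable]: "A \<in> sets borel" for A
  proof -
    have "f -` (I \<inter> A) \<in> sets borel" "f -` A \<in> sets borel"
      using measurable_sets[of f borel borel "I \<inter> A"] measurable_sets[of f borel borel A] by auto
    then have "emeasure lborel (f -` (I \<inter> A)) = emeasure lborel ({0..1} \<inter> f -` A)"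
      by (intro emeasure_eq_AE AEeq) auto
    then show ?thesis by (subst pull) auto
  qed
  have mI: "emeasure lborel I = ennreal (b - a)" using main[of UNIV] by simp
  show ?thesis
  proof (rule measure_eqI)
    fix A assume "A \<in> sets (distr (uniform_measure lborel {0..1}) borel (uniform_draw I))"
    then have [measurable]: "A \<in> sets borel" by simp
    have "f -` A \<in> sets borel" using measurable_sets[of f borel borel A] by simp
    then show "emeasure (distr (uniform_measure lborel {0..1}) borel (uniform_draw I)) A =
        emeasure (uniform_measure lborel I) A"
      using ab
      by (simp add: draw emeasure_distr emeasure_uniform_measure main mI
          divide_ennreal_def[of _ 1] ennreal_mult_divide_eq mult.commute[of "ennreal (b - a)"])
  qed simp
qed

definition p_CE :: "nat \<Rightarrow> nat \<Rightarrow> nat \<Rightarrow> real" where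
  "p_CE T t b = 1 - real b / (real T - real t + 1)"

text \<open>
  Here \<open>b\<close> is the budget remaining before time \<open>t\<close>, and \<open>Q\<close> is the finite set of gap quantiles.
\<close>

definition nearby_gaps :: "real set \<Rightarrow> nat \<Rightarrow> nat \<Rightarrow> nat \<Rightarrow> real set" where
  "nearby_gaps Q T t b =
     {q \<in> Q. \<bar>p_CE T t b - q\<bar> \<le> sqrt (2 * ln (real T - real t + 1) / (real T - real t + 1))}"

definition p_CwG :: "real set \<Rightarrow> nat \<Rightarrow> nat \<Rightarrow> nat \<Rightarrow> real" where
  "p_CwG Q T t b =
     (let S = nearby_gaps Q T t b
      in if S = {} then p_CE T t b else arg_min_on (\<lambda>q. \<bar>p_CE T t b - q\<bar>) S)"

definition phase_end :: "real \<Rightarrow> nat \<Rightarrow> nat" where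
  "phase_end \<epsilon>0 T = nat (max 0 (int T - \<lfloor>64 * ln (1 / \<epsilon>0) / \<epsilon>0\<^sup>2\<rfloor>))"

text \<open>
  \<open>cwg_remaining F Q \<epsilon>0 B T \<theta> u t\<close> is the budget left after the decision at time \<open>t\<close>, that is,
  \<open>B\<^bsub>t+1\<^esub>\<close>; the recursive call at \<open>phase_end \<epsilon>0 T\<close> retrieves the budget that determines the fixed
  threshold of the second phase.
\<close>

fun cwg_remaining ::
  "(real \<Rightarrow> real) \<Rightarrow> real set \<Rightarrow> real \<Rightarrow> nat \<Rightarrow> nat \<Rightarrow> (nat \<Rightarrow> real) \<Rightarrow> (nat \<Rightarrow> real) \<Rightarrow> nat \<Rightarrow> nat"
where
  "cwg_remaining F Q \<epsilon>0 B T \<theta> u 0 = B"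
| "cwg_remaining F Q \<epsilon>0 B T \<theta> u (Suc k) =
     (let t = Suc k;
          b = cwg_remaining F Q \<epsilon>0 B T \<theta> u k;
          p = (if Suc k \<le> phase_end \<epsilon>0 T then p_CwG Q T t b
               else p_CE T (phase_end \<epsilon>0 T + 1) (cwg_remaining F Q \<epsilon>0 B T \<theta> u (phase_end \<epsilon>0 T)))
      in if uniform_draw (quantile_set F (\<theta> t)) (u t) \<ge> p \<and> b > 0 then b - 1 else b)"

text \<open>An acceptance is exactly a unit decrease of the remaining budget.\<close>

definition cwg :: "(real \<Rightarrow> real) \<Rightarrow> real set \<Rightarrow> real \<Rightarrow> nat \<Rightarrow> nat \<Rightarrow> policy" where
  "cwg F Q \<epsilon>0 B T \<theta> u t =
     cwg_remaining F Q \<epsilon>0 B T \<theta> u (t - 1) - cwg_remaining F Q \<epsilon>0 B T \<theta> u t"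

lemma cwg_remaining_Suc_cases:
  "cwg_remaining F Q \<epsilon>0 B T \<theta> u (Suc k) \<in>
     {cwg_remaining F Q \<epsilon>0 B T \<theta> u k, cwg_remaining F Q \<epsilon>0 B T \<theta> u k - 1}"
  by (simp add: Let_def)

lemma cwg_remaining_cong:
  assumes "\<forall>s\<in>{1..t}. \<theta> s = \<theta>' s \<and> u s = u' s"
  shows "cwg_remaining F Q \<epsilon>0 B T \<theta> u t = cwg_remaining F Q \<epsilon>0 B T \<theta>' u' t"
  using assms
proof (induction t rule: less_induct)
  case (less t)
  show ?case
  proof (cases t)
    case (Suc k)
    have IH: "cwg_remaining F Q \<epsilon>0 B T \<theta> u j = cwg_remaining F Q \<epsilon>0 B T \<theta>' u' j" if "j \<le> k" for j
      using less that Suc by auto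
    have "\<theta> (Suc k) = \<theta>' (Suc k)" "u (Suc k) = u' (Suc k)" using less.prems Suc by auto
    then show ?thesis
      using IH[of k] IH[of "phase_end \<epsilon>0 T"] unfolding Suc cwg_remaining.simps Let_def by auto
  qed simp
qed

lemma admissible_cwg: "admissible B T (cwg F Q \<epsilon>0 B T)"
  unfolding admissible_def
proof (intro conjI allI ballI impI)
  fix \<theta> u :: "nat \<Rightarrow> real"
  let ?r = "cwg_remaining F Q \<epsilon>0 B T \<theta> u"
  show "cwg F Q \<epsilon>0 B T \<theta> u t \<in> {0, 1}" if "t \<in> {1..T}" for t
    using that cwg_remaining_Suc_cases[of F Q \<epsilon>0 B T \<theta> u "t - 1"] by (auto simp: cwg_def)
  have "(\<Sum>t=1..n. cwg F Q \<epsilon>0 B T \<theta> u t) + ?r n = B" for n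
  proof (induction n)
    case (Suc n)
    have "?r (Suc n) \<le> ?r n" using cwg_remaining_Suc_cases[of F Q \<epsilon>0 B T \<theta> u n] by auto
    then show ?case using Suc by (simp add: cwg_def del: cwg_remaining.simps(2))
  qed simp
  from this[of T] show "(\<Sum>t=1..T. cwg F Q \<epsilon>0 B T \<theta> u t) \<le> B" by linarith
next
  fix \<theta> \<theta>' u u' :: "nat \<Rightarrow> real" and t
  assume "t \<in> {1..T}" and *: "\<forall>s\<in>{1..t}. \<theta> s = \<theta>' s \<and> u s = u' s"
  then show "cwg F Q \<epsilon>0 B T \<theta> u t = cwg F Q \<epsilon>0 B T \<theta>' u' t"
    unfolding cwg_def
    by (intro arg_cong2[where f = minus] cwg_remaining_cong) auto
qed

definition D0 :: "real measure" where
  "D0 = uniform_measure lborel ({0..1/4} \<union> {3/4..1})"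

abbreviation F0 :: "real \<Rightarrow> real" where
  "F0 \<equiv> cdf D0"

end

theory Submission
  imports Defs
begin

text \<open>
  The regret is a sum of costs of single decisions, measured against an offline optimizer. Let
  \<open>hybrid k\<close> be the value of following the policy for \<open>k\<close> steps and then selecting the
  remaining candidates optimally in hindsight. Then the regret telescopes into the expected
  differences of consecutive hybrids, and each difference is the loss caused by one decision
  (\<open>step_loss\<close>): at most the distance between the ability of the candidate and that of the
  \<open>b\<close>-th best later candidate, and zero unless the decision was wrong. Here \<open>b\<close> is the remaining
  budget.

  Suppose that \<open>\<tau>\<close> candidates are left. In terms of quantile levels, which are uniform on
  \<open>[0, 1]\<close>, the \<open>b\<close>-th best later candidate has level close to \<open>m = 1 - b / \<tau>\<close>; by
  Hoeffding's inequality it is within \<open>s = sqrt (2 * ln \<tau> / \<tau>)\<close> of \<open>m\<close> except with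
  probability at most \<open>2 / \<tau>\<close> (\<open>count_tails\<close>). If \<open>m\<close> is farther than \<open>s\<close> from the gap level
  \<open>1/2\<close>, the threshold is \<open>m\<close> itself; then candidate and comparison level of a wrong decision
  lie on the same side of the gap and within \<open>s\<close> of \<open>m\<close> (\<open>step_loss_away_from_gap\<close>). If \<open>m\<close> is
  within \<open>s\<close> of \<open>1/2\<close>, the threshold is \<open>1/2\<close>; then a wrong decision again involves two levels
  on the same side of the gap, now within \<open>2 * s\<close> of \<open>1/2\<close> (\<open>step_loss_at_gap\<close>). In both cases
  a wrong decision has probability of order \<open>s\<close> and cost of order \<open>s\<close>. The expected loss is
  therefore of order \<open>1 / \<tau> + s\<^sup>2\<close>, that is, \<open>(1 + ln \<tau>) / \<tau>\<close>
  (\<open>expected_step_loss_bound\<close>). This holds for every value of the budget, so one can condition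
  on the past without knowing how the budget evolves (\<open>expected_hybrid_step\<close>). Summing over
  \<open>\<tau> \<le> T\<close> brings in a harmonic sum and gives \<open>256 * (1 + ln T)\<^sup>2\<close>.

  The second phase consists of boundedly many decisions, each of which loses at most \<open>1\<close>. For
  \<open>T \<ge> 2\<close> the term \<open>1 + ln T\<close> is at most \<open>3 * ln T\<close>; for \<open>T = 1\<close> the regret is not
  positive (\<open>regret_horizon_one\<close>).
\<close>

section \<open>Best selections in hindsight\<close>

definition best_sum :: "nat \<Rightarrow> 'i set \<Rightarrow> ('i \<Rightarrow> real) \<Rightarrow> real" where
  "best_sum b A \<theta> = Max ((\<lambda>S. sum \<theta> S) ` {S. S \<subseteq> A \<and> card S \<le> b})"

lemma best_sum_upper:
  assumes "finite A" "S \<subseteq> A" "card S \<le> b"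
  shows "sum \<theta> S \<le> best_sum b A \<theta>"
  unfolding best_sum_def using assms by (intro Max_ge) auto

lemma best_sum_attained:
  assumes "finite A"
  obtains S where "S \<subseteq> A" "card S \<le> b" "best_sum b A \<theta> = sum \<theta> S"
proof -
  let ?F = "{S. S \<subseteq> A \<and> card S \<le> b}"
  have "{} \<in> ?F" by simp
  then have "best_sum b A \<theta> \<in> (\<lambda>S. sum \<theta> S) ` ?F"
    unfolding best_sum_def using assms by (intro Max_in) auto
  then show thesis using that by auto
qed

lemma best_sum_empty [simp]: "best_sum b {} \<theta> = 0"
  by (simp add: best_sum_def conj_commute cong: conj_cong)

lemma best_sum_0:
  assumes "finite A"
  shows "best_sum 0 A \<theta> = 0"
  using best_sum_attained[OF assms, of 0 \<theta>] assms
  by (metis card_eq_0_iff finite_subset le_zero_eq sum.empty)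

lemma best_sum_bounds:
  assumes "finite A" "\<And>i. i \<in> A \<Longrightarrow> \<theta> i \<in> {0..1}"
  shows "best_sum b A \<theta> \<in> {0..real (card A)}"
proof -
  obtain S where S: "S \<subseteq> A" "best_sum b A \<theta> = sum \<theta> S"
    using best_sum_attained[OF assms(1)] by metis
  have "sum \<theta> S \<le> sum (\<lambda>_. 1) S" using S assms by (intro sum_mono) auto
  moreover have "card S \<le> card A" using S assms by (intro card_mono)
  moreover have "0 \<le> best_sum b A \<theta>" using best_sum_upper[OF assms(1), of "{}" b \<theta>] by simp
  ultimately show ?thesis using S by auto
qed

lemma best_sum_cong:
  assumes "\<And>i. i \<in> A \<Longrightarrow> \<theta> i = \<theta>' i"
  shows "best_sum b A \<theta> = best_sum b A \<theta>'"
  unfolding best_sum_def using assms by (intro arg_cong[where f = Max] image_cong sum.cong) auto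

text \<open>
  An exchange argument bounds the cost of spending one unit of budget on candidate \<open>t\<close>. An
  optimal selection that omits \<open>t\<close> and exhausts the budget contains \<open>b\<close> of the other candidates,
  hence one worth at most \<open>c\<close>; replacing that one by \<open>t\<close> costs at most \<open>c - \<theta> t\<close>.
\<close>

lemma best_sum_insert_accept:
  assumes A: "finite A" "t \<notin> A" and nonneg: "0 \<le> \<theta> t"
    and few: "card {i\<in>A. c < \<theta> i} < b"
  shows "best_sum b (insert t A) \<theta> \<le> \<theta> t + best_sum (b - 1) A \<theta> + max 0 (c - \<theta> t)"
proof -
  obtain S where S: "S \<subseteq> insert t A" "card S \<le> b" "best_sum b (insert t A) \<theta> = sum \<theta> S"
    using best_sum_attained[of "insert t A" b \<theta>] A by auto
  have fin: "finite S" using S(1) A(1) finite_subset by blast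
  consider "t \<in> S" | "t \<notin> S" "card S < b" | "t \<notin> S" "card S = b" using S(2) by linarith
  then show ?thesis
  proof cases
    case 1
    have "sum \<theta> (S - {t}) \<le> best_sum (b - 1) A \<theta>"
      using 1 S fin A by (intro best_sum_upper) auto
    then show ?thesis using S(3) sum.remove[OF fin 1, of \<theta>] by simp
  next
    case 2
    have "sum \<theta> S \<le> best_sum (b - 1) A \<theta>"
      using 2 S A by (intro best_sum_upper) auto
    then show ?thesis using S(3) nonneg by simp
  next
    case 3
    have sub: "S \<subseteq> A" using S(1) 3 by auto
    have "\<not> S \<subseteq> {i\<in>A. c < \<theta> i}"
      using card_mono[of "{i\<in>A. c < \<theta> i}" S] few 3 A by auto
    then obtain i where i: "i \<in> S" "\<theta> i \<le> c" using sub by force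
    have "sum \<theta> (S - {i}) \<le> best_sum (b - 1) A \<theta>"
      using 3 sub fin i A by (intro best_sum_upper) auto
    then show ?thesis using S(3) i sum.remove[OF fin i(1), of \<theta>] by simp
  qed
qed

text \<open>
  Dually, an optimal selection that uses \<open>t\<close> leaves at least one of the \<open>b\<close> other candidates
  above \<open>c\<close> unused, and that one can take the place of \<open>t\<close>.
\<close>

lemma best_sum_insert_reject:
  assumes A: "finite A" "t \<notin> A"
    and many: "b \<le> card {i\<in>A. c < \<theta> i}"
  shows "best_sum b (insert t A) \<theta> \<le> best_sum b A \<theta> + max 0 (\<theta> t - c)"
proof -
  obtain S where S: "S \<subseteq> insert t A" "card S \<le> b" "best_sum b (insert t A) \<theta> = sum \<theta> S"
    using best_sum_attained[of "insert t A" b \<theta>] A by auto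
  have fin: "finite S" using S(1) A(1) finite_subset by blast
  show ?thesis
  proof (cases "t \<in> S")
    case False
    then have "sum \<theta> S \<le> best_sum b A \<theta>" using S A by (intro best_sum_upper) auto
    then show ?thesis using S(3) by simp
  next
    case True
    have card: "card (S - {t}) < b"
      using S(2) fin True by (meson card_Diff1_less less_le_trans)
    have "\<not> {i\<in>A. c < \<theta> i} \<subseteq> S - {t}"
      using card_mono[of "S - {t}" "{i\<in>A. c < \<theta> i}"] many card fin by auto
    then obtain i where i: "i \<in> A" "c < \<theta> i" "i \<notin> S - {t}" by auto
    have "sum \<theta> (insert i (S - {t})) \<le> best_sum b A \<theta>"
      using card S(1) fin i A by (intro best_sum_upper) auto
    then show ?thesis using S(3) i fin sum.remove[OF fin True, of \<theta>] by simp
  qed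
qed

lemma best_sum_insert_le:
  assumes A: "finite A" "t \<notin> A" and nonneg: "0 \<le> \<theta> t"
  shows "best_sum b (insert t A) \<theta> \<le> best_sum b A \<theta> + \<theta> t"
proof -
  obtain S where S: "S \<subseteq> insert t A" "card S \<le> b" "best_sum b (insert t A) \<theta> = sum \<theta> S"
    using best_sum_attained[of "insert t A" b \<theta>] A by auto
  have fin: "finite S" using S(1) A(1) finite_subset by blast
  have "sum \<theta> (S - {t}) \<le> best_sum b A \<theta>"
    using S fin A by (intro best_sum_upper) (auto intro: order_trans[OF card_Diff1_le])
  moreover have "sum \<theta> S \<le> sum \<theta> (S - {t}) + \<theta> t"
    using nonneg fin by (cases "t \<in> S") (auto simp: sum.remove)
  ultimately show ?thesis using S(3) by simp
qed

lemma borel_measurable_best_sum: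
  assumes "finite A" "\<And>i. i \<in> A \<Longrightarrow> (\<lambda>\<omega>. \<theta> \<omega> i) \<in> borel_measurable M"
  shows "(\<lambda>\<omega>. best_sum b A (\<theta> \<omega>)) \<in> borel_measurable M"
  unfolding best_sum_def using assms
  by (intro borel_measurable_Max borel_measurable_sum) (auto intro: finite_subset[of _ "Pow A"])

lemma hindsight_eq_best_sum: "hindsight B T \<theta> = best_sum B {1..T} \<theta>"
proof -
  have "{(\<Sum>t=1..T. \<theta> t * real (a t)) | a :: nat \<Rightarrow> nat.
            a \<in> {1..T} \<rightarrow>\<^sub>E {0, 1} \<and> (\<Sum>t=1..T. a t) \<le> B}
      = (\<lambda>S. sum \<theta> S) ` {S. S \<subseteq> {1..T} \<and> card S \<le> B}" (is "?L = ?R")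
  proof (intro equalityI subsetI)
    fix x assume "x \<in> ?L"
    then obtain a :: "nat \<Rightarrow> nat" where a: "a \<in> {1..T} \<rightarrow>\<^sub>E {0, 1}" "(\<Sum>t=1..T. a t) \<le> B"
      and x: "x = (\<Sum>t=1..T. \<theta> t * real (a t))" by auto
    define S where "S = {t\<in>{1..T}. a t = 1}"
    have ind: "a t = (if t \<in> S then 1 else 0)" if "t \<in> {1..T}" for t
      using a(1) that by (auto simp: S_def PiE_iff)
    have sub: "S \<subseteq> {1..T}" by (auto simp: S_def)
    have "x = (\<Sum>t\<in>{1..T}. if t \<in> S then \<theta> t else 0)"
      unfolding x by (intro sum.cong) (simp_all add: ind)
    also have "\<dots> = sum \<theta> S" using sub by (simp add: sum.inter_restrict[symmetric] Int_absorb1)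
    finally have "x = sum \<theta> S" .
    moreover have "card S \<le> B"
    proof -
      have "(\<Sum>t=1..T. a t) = (\<Sum>t\<in>{1..T}. if t \<in> S then 1 else 0)"
        by (intro sum.cong) (simp_all add: ind)
      also have "\<dots> = card S" using sub by (simp add: sum.inter_restrict[symmetric] Int_absorb1)
      finally show ?thesis using a(2) by simp
    qed
    ultimately show "x \<in> ?R" using sub by blast
  next
    fix x assume "x \<in> ?R"
    then obtain S where S: "S \<subseteq> {1..T}" "card S \<le> B" "x = sum \<theta> S" by auto
    define a where "a = (\<lambda>t\<in>{1..T}. if t \<in> S then 1 else 0 :: nat)"
    have "a \<in> {1..T} \<rightarrow>\<^sub>E {0, 1}" by (auto simp: a_def)
    moreover have "(\<Sum>t=1..T. a t) = (\<Sum>t\<in>{1..T}. if t \<in> S then 1 else 0)"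
      by (intro sum.cong) (simp_all add: a_def)
    moreover have "(\<Sum>t=1..T. \<theta> t * real (a t)) = (\<Sum>t\<in>{1..T}. if t \<in> S then \<theta> t else 0)"
      by (intro sum.cong) (simp_all add: a_def)
    ultimately have "a \<in> {1..T} \<rightarrow>\<^sub>E {0, 1} \<and> (\<Sum>t=1..T. a t) \<le> B" "x = (\<Sum>t=1..T. \<theta> t * real (a t))"
      using S by (simp_all add: sum.inter_restrict[symmetric] Int_absorb1)
    then show "x \<in> ?L" by blast
  qed
  then show ?thesis by (simp add: hindsight_def best_sum_def)
qed


section \<open>The ability law and its quantile function\<close>

text \<open>
  The quantile function of the law, extended linearly to all reals. The extension lies outside
  \<open>[0, 1]\<close> for levels outside \<open>[0, 1]\<close>, so that perturbed levels \<open>m \<plusminus> s\<close> never have to be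
  truncated.
\<close>

definition quantile0 :: "real \<Rightarrow> real" where
  "quantile0 q = q / 2 + (if q \<le> 1/2 then 0 else 1/2)"

lemma emeasure_lborel_support: "emeasure lborel ({0..1/4} \<union> {3/4..1::real}) = ennreal (1/2)"
proof -
  have "emeasure lborel ({0..1/4} \<union> {3/4..1::real}) = ennreal (1/4) + ennreal (1/4)"
    by (subst plus_emeasure[symmetric]) auto
  then show ?thesis by (simp flip: ennreal_plus)
qed

lemma sets_D0 [simp, measurable_cong]: "sets D0 = sets borel"
  by (simp add: D0_def)

lemma space_D0 [simp]: "space D0 = UNIV"
  by (simp add: D0_def)

interpretation D0: prob_space D0
  unfolding D0_def by (rule prob_space_uniform_measure) (simp_all add: emeasure_lborel_support)

lemma emeasure_D0:
  assumes "A \<in> sets borel"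
  shows "emeasure D0 A = 2 * emeasure lborel (({0..1/4} \<union> {3/4..1}) \<inter> A)"
proof -
  have "inverse (ennreal (1/2)) = 2" by (subst inverse_ennreal) auto
  then show ?thesis using assms unfolding D0_def
    by (subst emeasure_uniform_measure)
       (simp_all add: emeasure_lborel_support divide_ennreal_def mult.commute[of _ 2])
qed

text \<open>
  The support of the law without the inner endpoints \<open>1/4\<close> and \<open>3/4\<close> of the gap. On this set no
  ability has quantile level exactly \<open>1/2\<close>, so comparing levels with \<open>1/2\<close> is the same as asking
  on which side of the gap an ability lies.
\<close>

definition support0 :: "real set" where
  "support0 = {0..<1/4} \<union> {3/4<..1}"

lemma AE_D0: "AE x in D0. x \<in> support0"
  unfolding support0_def
proof (rule AE_I')
  have sub: "({0..1/4} \<union> {3/4..1}) \<inter> (- ({0..<1/4} \<union> {3/4<..1})) = {1/4, 3/4::real}" by auto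
  have "emeasure D0 (- ({0..<1/4} \<union> {3/4<..1})) = 0"
    by (subst emeasure_D0, simp, unfold sub) (simp add: emeasure_lborel_countable)
  then show "- ({0..<1/4} \<union> {3/4<..1}) \<in> null_sets D0"
    by (intro null_setsI) auto
qed auto

lemma cdf_D0:
  "F0 v = (if v < 0 then 0 else if v \<le> 1/4 then 2 * v else if v \<le> 3/4 then 1/2
           else if v \<le> 1 then 2 * v - 1 else 1)"
proof -
  have E: "emeasure D0 {..v} = 2 * (emeasure lborel {0..min v (1/4)} + emeasure lborel {3/4..min v 1})"
  proof -
    have "({0..1/4} \<union> {3/4..1}) \<inter> {..v} = {0..min v (1/4)} \<union> {3/4..min v 1}" by auto
    then show ?thesis
      by (subst emeasure_D0) (auto intro!: arg_cong[where f = "\<lambda>x. 2 * x"] plus_emeasure[symmetric]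
          simp del: distrib_left_numeral)
  qed
  have E2: "emeasure D0 {..v} = ennreal (2 * (max 0 (min v (1/4)) + max 0 (min v 1 - 3/4)))"
  proof -
    have "emeasure lborel {0..min v (1/4)} = ennreal (max 0 (min v (1/4)))"
      "emeasure lborel {3/4..min v 1} = ennreal (max 0 (min v 1 - 3/4))"
      by (auto simp: emeasure_lborel_Icc_eq max_def)
    then show ?thesis unfolding E by (simp add: ennreal_mult)
  qed
  have "F0 v = 2 * (max 0 (min v (1/4)) + max 0 (min v 1 - 3/4))"
    unfolding cdf_def measure_def E2 by (rule enn2real_ennreal) simp
  then show ?thesis by (simp add: max_def min_def)
qed

lemma quantile_F0:
  assumes "q \<in> {0..1}"
  shows "quantile F0 q = quantile0 q"
proof -
  have "v \<in> {0..1} \<and> F0 v \<ge> q \<longleftrightarrow> v \<in> {quantile0 q..1}" for v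
    using assms unfolding cdf_D0 quantile0_def by (simp split: if_splits; linarith)
  then have "{v \<in> {0..1}. F0 v \<ge> q} = {quantile0 q..1}" by blast
  moreover have "quantile0 q \<le> 1" using assms by (auto simp: quantile0_def)
  ultimately show ?thesis by (simp add: quantile_def)
qed

lemma quantile_set_F0:
  "quantile_set F0 x = (if x \<in> {0..1/4} then {2 * x} else if x \<in> {3/4<..1} then {2 * x - 1} else {})"
proof -
  have "quantile_set F0 x = {q \<in> {0..1}. quantile0 q = x}"
    unfolding quantile_set_def by (intro Collect_cong conj_cong refl) (simp only: quantile_F0)
  moreover have "q \<in> {0..1} \<and> quantile0 q = x \<longleftrightarrow>
      x \<in> {0..1/4} \<and> q = 2 * x \<or> x \<in> {3/4<..1} \<and> q = 2 * x - 1" for q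
    unfolding quantile0_def atLeastAtMost_iff greaterThanAtMost_iff
    by (cases "q \<le> 1/2"; simp; argo)
  ultimately have "quantile_set F0 x =
      {q. x \<in> {0..1/4} \<and> q = 2 * x \<or> x \<in> {3/4<..1} \<and> q = 2 * x - 1}"
    by (simp only:)
  then show ?thesis by auto
qed

lemma D0_tail:
  assumes "q \<in> {0..1}"
  shows "measure D0 {quantile0 q<..} = 1 - q"
proof -
  have "measure D0 {quantile0 q<..} = 1 - F0 (quantile0 q)"
    using D0.prob_compl[of "{..quantile0 q}"]
    by (simp add: cdf_def Compl_eq_Diff_UNIV[symmetric])
  then show ?thesis using assms by (auto simp: cdf_D0 quantile0_def)
qed

lemma D0_measure_le:
  assumes "A \<in> sets borel" "emeasure lborel A \<le> ennreal l" "0 \<le> l"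
  shows "measure D0 A \<le> 2 * l"
proof -
  have "emeasure D0 A \<le> 2 * emeasure lborel A"
    using assms by (subst emeasure_D0) (auto intro!: mult_left_mono emeasure_mono)
  also have "\<dots> \<le> 2 * ennreal l" using assms by (intro mult_left_mono) auto
  also have "\<dots> = ennreal (2 * l)" by (simp add: ennreal_mult')
  finally show ?thesis using assms by (simp add: measure_def enn2real_leI)
qed

text \<open>
  The quantile level of an ability in the support; it inverts \<open>quantile0\<close> there.
\<close>

definition rank0 :: "real \<Rightarrow> real" where
  "rank0 x = (if x \<le> 1/2 then 2 * x else 2 * x - 1)"

lemma quantile0_mono: "p \<le> q \<Longrightarrow> quantile0 p \<le> quantile0 q"
  by (auto simp: quantile0_def)

lemma quantile0_rank0: "x \<in> support0 \<Longrightarrow> quantile0 (rank0 x) = x"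
  by (auto simp: quantile0_def rank0_def support0_def field_simps)

lemma rank0_bounds: "x \<in> support0 \<Longrightarrow> 0 \<le> rank0 x"
  by (auto simp: rank0_def support0_def)

lemma support0_bounds: "x \<in> support0 \<Longrightarrow> 0 \<le> x \<and> x \<le> 1"
  by (auto simp: support0_def)

lemma uniform_draw_F0:
  assumes "x \<in> support0"
  shows "uniform_draw (quantile_set F0 x) u = rank0 x"
  using assms by (auto simp: support0_def quantile_set_F0 uniform_draw_singleton rank0_def)

text \<open>
  The draw has to be a measurable function on the whole sample space; off the support the set of
  levels is empty, and the draw is a fixed affine function of the seed.
\<close>

lemma uniform_draw_F0_cases:
  "uniform_draw (quantile_set F0 x) u =
     (if x \<in> {0..1/4} then 2 * x else if x \<in> {3/4<..1} then 2 * x - 1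
      else Inf {} + u * (Sup {} - Inf {}))"
  unfolding quantile_set_F0 by (auto simp: uniform_draw_def)

section \<open>The loss of a single decision\<close>

text \<open>
  What the decision about \<open>t\<close> costs an offline optimizer who takes over afterwards: \<open>b\<close> is the
  budget before the decision, \<open>A\<close> the set of later candidates, and \<open>t\<close> is accepted when its
  drawn level \<open>x\<close> reaches the threshold \<open>p\<close>.
\<close>

definition step_loss :: "nat \<Rightarrow> 'i set \<Rightarrow> real \<Rightarrow> real \<Rightarrow> ('i \<Rightarrow> real) \<Rightarrow> 'i \<Rightarrow> real" where
  "step_loss b A p x \<theta> t = best_sum b (insert t A) \<theta> -
     (if p \<le> x \<and> 0 < b then \<theta> t + best_sum (b - 1) A \<theta> else best_sum b A \<theta>)"

context
  fixes A :: "'i set" and t :: 'i and \<theta> :: "'i \<Rightarrow> real"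
  assumes A: "finite A" "t \<notin> A" and bounds: "\<And>i. i \<in> insert t A \<Longrightarrow> \<theta> i \<in> support0"
begin

lemma in_unit_interval: "i \<in> insert t A \<Longrightarrow> 0 \<le> \<theta> i" "i \<in> insert t A \<Longrightarrow> \<theta> i \<le> 1"
  using bounds support0_bounds by blast+

lemma step_loss_le_one: "step_loss b A p x \<theta> t \<le> 1"
proof -
  have "best_sum b (insert t A) \<theta> \<le> best_sum b A \<theta> + \<theta> t"
    using A in_unit_interval by (intro best_sum_insert_le) auto
  moreover have "best_sum b (insert t A) \<theta> \<le> \<theta> t + best_sum (b - 1) A \<theta> + max 0 (1 - \<theta> t)" if "0 < b"
  proof (rule best_sum_insert_accept)
    have none: "{i\<in>A. 1 < \<theta> i} = {}" using in_unit_interval by force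
    show "card {i \<in> A. 1 < \<theta> i} < b" unfolding none using that by simp
  qed (use A in_unit_interval in auto)
  ultimately show ?thesis using in_unit_interval[of t] by (auto simp: step_loss_def)
qed

text \<open>
  With no budget or with more budget than remaining candidates, nothing can be lost (in the
  second case provided that \<open>t\<close> is accepted).
\<close>

lemma step_loss_no_budget: "step_loss 0 A p x \<theta> t \<le> 0"
  using A by (simp add: step_loss_def best_sum_0)

lemma step_loss_ample_budget:
  assumes "card A < b" "p \<le> x"
  shows "step_loss b A p x \<theta> t \<le> 0"
proof -
  have "best_sum b (insert t A) \<theta> \<le> \<theta> t + best_sum (b - 1) A \<theta> + max 0 (0 - \<theta> t)"
    using A in_unit_interval assms
    by (intro best_sum_insert_accept) (auto intro: order.strict_trans1[OF card_mono])
  then show ?thesis using assms in_unit_interval[of t] by (auto simp: step_loss_def)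
qed

text \<open>
  The two counting hypotheses say that the \<open>b\<close>-th best later candidate has a level between
  \<open>m - s\<close> and \<open>m + s\<close>. A wrong decision then needs a candidate whose ability lies between
  the threshold and one of the two abilities at these levels.
\<close>

lemma step_loss_threshold:
  assumes few: "card {i\<in>A. quantile0 (m + s) < \<theta> i} < b"
    and many: "b \<le> card {i\<in>A. quantile0 (m - s) < \<theta> i}"
  shows "step_loss b A p (rank0 (\<theta> t)) \<theta> t \<le>
    (if p \<le> rank0 (\<theta> t) then max 0 (quantile0 (m + s) - \<theta> t) else max 0 (\<theta> t - quantile0 (m - s)))"
proof -
  have "best_sum b (insert t A) \<theta> \<le> \<theta> t + best_sum (b - 1) A \<theta> + max 0 (quantile0 (m + s) - \<theta> t)"
    using A in_unit_interval few by (intro best_sum_insert_accept) auto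
  moreover have "best_sum b (insert t A) \<theta> \<le> best_sum b A \<theta> + max 0 (\<theta> t - quantile0 (m - s))"
    using A many by (rule best_sum_insert_reject)
  moreover have "0 < b" using few by simp
  ultimately show ?thesis by (simp add: step_loss_def)
qed

text \<open>
  Since \<open>s < \<bar>m - 1/2\<bar>\<close>, the whole window \<open>m \<plusminus> s\<close> of levels lies on one side of the gap,
  where the quantile function is linear with slope \<open>1/2\<close>. Hence a wrong decision is both rare
  and cheap.
\<close>

lemma step_loss_away_from_gap:
  assumes "card {i\<in>A. quantile0 (m + s) < \<theta> i} < b"
    and "b \<le> card {i\<in>A. quantile0 (m - s) < \<theta> i}"
    and s: "0 \<le> s" "s < \<bar>m - 1/2\<bar>"
  shows "step_loss b A m (rank0 (\<theta> t)) \<theta> t \<le>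
    s * indicator {quantile0 m - s/2..quantile0 m + s/2} (\<theta> t)"
proof -
  have shift: "quantile0 (m + s) = quantile0 m + s/2" "quantile0 (m - s) = quantile0 m - s/2"
    using s by (auto simp: quantile0_def)
  have "m \<le> rank0 (\<theta> t) \<Longrightarrow> quantile0 m \<le> \<theta> t" "\<not> m \<le> rank0 (\<theta> t) \<Longrightarrow> \<theta> t \<le> quantile0 m"
    using quantile0_mono[of m "rank0 (\<theta> t)"] quantile0_mono[of "rank0 (\<theta> t)" m]
      quantile0_rank0[OF bounds, of t] by auto
  then show ?thesis
    using s by (intro order_trans[OF step_loss_threshold[OF assms(1,2), of m]], unfold shift,
      cases "m \<le> rank0 (\<theta> t)") (auto simp: indicator_def max_def)
qed

text \<open>
  Thresholding at the gap level is what makes errors cheap here: whenever the candidate is on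
  the wrong side of the comparison level, that level is on the same side of the gap as the
  candidate, so the loss never contains the width of the gap.
\<close>

lemma step_loss_at_gap:
  assumes "card {i\<in>A. quantile0 (m + s) < \<theta> i} < b"
    and "b \<le> card {i\<in>A. quantile0 (m - s) < \<theta> i}"
    and s: "0 \<le> s" "\<bar>m - 1/2\<bar> \<le> s"
  shows "step_loss b A (1/2) (rank0 (\<theta> t)) \<theta> t \<le>
    s * indicator ({1/4 - s..1/4} \<union> {3/4..3/4 + s}) (\<theta> t)"
proof -
  have hi: "quantile0 (m + s) \<le> 3/4 + s" and lo: "1/4 - s \<le> quantile0 (m - s)"
    using s by (auto simp: quantile0_def field_simps)
  have "1/2 \<le> rank0 (\<theta> t) \<Longrightarrow> 3/4 \<le> \<theta> t" "\<not> 1/2 \<le> rank0 (\<theta> t) \<Longrightarrow> \<theta> t \<le> 1/4"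
    using bounds[of t] by (auto simp: rank0_def support0_def split: if_splits)
  then show ?thesis
    using s hi lo by (intro order_trans[OF step_loss_threshold[OF assms(1,2), of "1/2"]])
      (auto simp: indicator_def max_def)
qed

end

section \<open>Concentration of the number of good candidates\<close>

abbreviation observation :: "(real \<times> real) measure" where
  "observation \<equiv> D0 \<Otimes>\<^sub>M uniform_measure lborel {0..1}"

interpretation seed: prob_space "uniform_measure lborel {0..1::real}"
  by (rule prob_space_uniform_measure) simp_all

interpretation observation: prob_space observation
proof -
  interpret pair: pair_prob_space D0 "uniform_measure lborel {0..1::real}" ..
  show "prob_space observation" by (rule pair.prob_space_axioms)
qed

lemma distr_fst_observation: "distr observation D0 fst = D0"
  by (rule seed.distr_pair_fst)

lemma AE_observation: "AE z in observation. fst z \<in> support0"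
proof (rule AE_distrD[of fst observation D0])
  show "AE x in distr observation D0 fst. x \<in> support0"
    unfolding distr_fst_observation by (rule AE_D0)
qed simp

lemma measure_observation:
  assumes "S \<in> sets borel"
  shows "measure observation {z. fst z \<in> S} = measure D0 S"
proof -
  have "measure D0 S = measure (distr observation D0 fst) S" by (simp only: distr_fst_observation)
  also have "\<dots> = measure observation (fst -` S \<inter> space observation)"
    using assms by (intro measure_distr) auto
  also have "fst -` S \<inter> space observation = {z. fst z \<in> S}"
    by (auto simp: space_pair_measure)
  finally show ?thesis ..
qed

lemma prob_space_PiM_observation: "prob_space (PiM J (\<lambda>_. observation))"
  by (intro prob_space_PiM observation.prob_space_axioms)

lemma AE_PiM_support:
  assumes "finite J"
  shows "AE y in PiM J (\<lambda>_. observation). \<forall>i\<in>J. fst (y i) \<in> support0"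
  using assms by (intro AE_finite_allI AE_PiM_component AE_observation observation.prob_space_axioms)

text \<open>
  Coordinates of a product measure are independent, because their joint law is the product
  measure itself.
\<close>

lemma indep_vars_coordinates:
  assumes "A \<subseteq> J"
  shows "prob_space.indep_vars (PiM J (\<lambda>_. observation)) (\<lambda>_. observation) (\<lambda>i y. y i) A"
proof (cases "A = {}")
  case True
  interpret P: prob_space "PiM J (\<lambda>_. observation)" by (rule prob_space_PiM_observation)
  show ?thesis unfolding True P.indep_vars_def P.indep_sets_def by auto
next
  case False
  interpret P: prob_space "PiM J (\<lambda>_. observation)" by (rule prob_space_PiM_observation)
  have "P.indep_vars (\<lambda>_. observation) (\<lambda>i y. y i) J"
  proof (subst P.indep_vars_iff_distr_eq_PiM')
    have "distr (PiM J (\<lambda>_. observation)) (PiM J (\<lambda>_. observation)) (\<lambda>x. \<lambda>i\<in>J. x i) =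
        distr (PiM J (\<lambda>_. observation)) (PiM J (\<lambda>_. observation)) (\<lambda>x. x)"
      by (intro distr_cong) (auto simp: space_PiM)
    moreover have "PiM J (\<lambda>i. distr (PiM J (\<lambda>_. observation)) observation (\<lambda>y. y i)) =
        PiM J (\<lambda>_. observation)"
      by (intro PiM_cong refl distr_PiM_component observation.prob_space_axioms)
    ultimately show "distr (PiM J (\<lambda>_. observation)) (PiM J (\<lambda>_. observation)) (\<lambda>x. \<lambda>i\<in>J. x i) =
      PiM J (\<lambda>i. distr (PiM J (\<lambda>_. observation)) observation (\<lambda>y. y i))" by (simp add: distr_id)
  qed (use False assms in auto)
  then show ?thesis using assms by (rule P.indep_vars_subset)
qed

lemma count_concentration:
  fixes A J :: "'i set" and v :: real
  assumes A: "finite A" "A \<noteq> {}" "A \<subseteq> J" and \<epsilon>: "0 \<le> \<epsilon>"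
  defines "P \<equiv> PiM J (\<lambda>_. observation)" and "\<mu> \<equiv> real (card A) * measure D0 {v<..}"
  shows "measure P {y\<in>space P. \<mu> + \<epsilon> \<le> real (card {i\<in>A. v < fst (y i)})} \<le> exp (-2 * \<epsilon>\<^sup>2 / card A)"
    and "measure P {y\<in>space P. real (card {i\<in>A. v < fst (y i)}) \<le> \<mu> - \<epsilon>} \<le> exp (-2 * \<epsilon>\<^sup>2 / card A)"
proof -
  interpret P: prob_space P unfolding P_def by (rule prob_space_PiM_observation)
  define X :: "'i \<Rightarrow> ('i \<Rightarrow> real \<times> real) \<Rightarrow> real" where "X i y = indicator {z. v < fst z} (y i)" for i y
  have [measurable]: "{z. v < fst z} \<in> sets observation"
    using measurable_sets[of fst observation borel "{v<..}"]
    by (simp add: vimage_def space_pair_measure)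
  have indep: "P.indep_vars (\<lambda>_. borel) X A"
    unfolding X_def P_def
    by (intro prob_space.indep_vars_compose2[OF prob_space_PiM_observation indep_vars_coordinates] A) measurable
  interpret indep_interval_bounded_random_variables P A X "\<lambda>_. 0" "\<lambda>_. 1"
    by unfold_locales (use A indep in \<open>auto simp: X_def indicator_def\<close>)
  have E: "P.expectation (X i) = measure D0 {v<..}" if "i \<in> A" for i
  proof -
    have i: "i \<in> J" using A that by auto
    have "P.expectation (X i) = (\<integral>z. indicator {z. v < fst z} z \<partial>distr P observation (\<lambda>y. y i))"
      unfolding X_def P_def using i by (subst integral_distr) auto
    also have "distr P observation (\<lambda>y. y i) = observation"
      unfolding P_def using i by (intro distr_PiM_component observation.prob_space_axioms)
    also have "(\<integral>z. indicator {z. v < fst z} z \<partial>observation) = measure observation {z. v < fst z}"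
      by (simp add: space_pair_measure)
    finally show ?thesis using measure_observation[of "{v<..}"] by simp
  qed
  interpret Hoeffding_ineq P A X "\<lambda>_. 0" "\<lambda>_. 1" \<mu>
    by unfold_locales (simp add: E \<mu>_def)
  have count: "real (card {i\<in>A. v < fst (y i)}) = (\<Sum>i\<in>A. X i y)" for y
    using A by (simp add: X_def indicator_def sum.If_cases Int_def)
  show "measure P {y\<in>space P. \<mu> + \<epsilon> \<le> real (card {i\<in>A. v < fst (y i)})} \<le> exp (-2 * \<epsilon>\<^sup>2 / card A)"
    unfolding count using Hoeffding_ineq_ge[OF \<epsilon>] A by (simp add: card_gt_0_iff)
  show "measure P {y\<in>space P. real (card {i\<in>A. v < fst (y i)}) \<le> \<mu> - \<epsilon>} \<le> exp (-2 * \<epsilon>\<^sup>2 / card A)"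
    unfolding count using Hoeffding_ineq_le[OF \<epsilon>] A by (simp add: card_gt_0_iff)
qed

lemma measurable_fst_component [measurable]:
  "i \<in> J \<Longrightarrow> (\<lambda>y. fst (y i)) \<in> borel_measurable (PiM J (\<lambda>_. observation))"
  "i \<in> J \<Longrightarrow> (\<lambda>y. snd (y i)) \<in> borel_measurable (PiM J (\<lambda>_. observation))"
  by (auto intro!: measurable_compose[OF measurable_component_singleton])

lemma measurable_count:
  assumes "finite A" "A \<subseteq> J"
  shows "(\<lambda>y. card {i\<in>A. v < fst (y i)}) \<in> measurable (PiM J (\<lambda>_. observation)) (count_space UNIV)"
proof -
  have "(\<lambda>y. \<Sum>i\<in>A. indicator {v<..} (fst (y i)) :: real) \<in> borel_measurable (PiM J (\<lambda>_. observation))"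
    using assms by (intro borel_measurable_sum borel_measurable_indicator') auto
  also have "(\<lambda>y. \<Sum>i\<in>A. indicator {v<..} (fst (y i)) :: real) =
      (\<lambda>y. real (card {i\<in>A. v < fst (y i)}))"
    using assms by (simp add: indicator_def sum.If_cases Int_def)
  finally show ?thesis by (rule measurable_real_imp_nat)
qed

lemma integral_indicator_component:
  assumes "t \<in> J" "S \<in> sets borel"
  shows "(\<integral>y. indicat_real S (fst (y t)) \<partial>PiM J (\<lambda>_. observation)) = measure D0 S"
proof -
  have "(\<integral>y. indicat_real S (fst (y t)) \<partial>PiM J (\<lambda>_. observation)) =
      (\<integral>z. indicat_real S (fst z) \<partial>distr (PiM J (\<lambda>_. observation)) observation (\<lambda>y. y t))"
    using assms by (subst integral_distr) auto
  also have "distr (PiM J (\<lambda>_. observation)) observation (\<lambda>y. y t) = observation"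
    using assms by (intro distr_PiM_component observation.prob_space_axioms)
  also have "(\<integral>z. indicat_real S (fst z) \<partial>observation) = (\<integral>x. indicat_real S x \<partial>distr observation D0 fst)"
    using assms by (subst integral_distr) auto
  finally show ?thesis by (simp add: distr_fst_observation)
qed

lemma (in prob_space) integral_le_nonneg_const:
  fixes c :: real
  assumes "AE x in M. f x \<le> c" "0 \<le> c"
  shows "integral\<^sup>L M f \<le> c"
  using integral_mono_AE'[of M "\<lambda>_. c" f] assms prob_space by simp

text \<open>
  With \<open>\<tau> = n + 1\<close> candidates left including the present one, the level
  \<open>m = 1 - b / \<tau>\<close> is the one exceeded by about \<open>b\<close> of the \<open>n\<close> later ones. The radius \<open>s\<close>
  is chosen so that Hoeffding's bound \<open>exp (- 2 n s\<^sup>2) = \<tau> powr (- 4 n / \<tau>)\<close> is at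
  most \<open>1 / \<tau>\<close>. A shifted level that leaves \<open>[0, 1]\<close> makes the count deterministic.
\<close>

lemma count_tails:
  fixes A J :: "'i set" and b :: nat
  assumes A: "finite A" "A \<subseteq> J" and J: "finite J" and b: "1 \<le> b" "b \<le> card A"
  defines "P \<equiv> PiM J (\<lambda>_. observation)" and "\<tau> \<equiv> real (card A) + 1"
  defines "m \<equiv> 1 - real b / \<tau>" and "s \<equiv> sqrt (2 * ln \<tau> / \<tau>)"
  shows "measure P {y\<in>space P. b \<le> card {i\<in>A. quantile0 (m + s) < fst (y i)}} \<le> 1 / \<tau>" (is ?few)
    and "measure P {y\<in>space P. card {i\<in>A. quantile0 (m - s) < fst (y i)} < b} \<le> 1 / \<tau>" (is ?many)
proof -
  interpret P: prob_space P unfolding P_def by (rule prob_space_PiM_observation)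
  have [measurable]: "(\<lambda>y. card {i\<in>A. v < fst (y i)}) \<in> measurable P (count_space UNIV)" for v
    unfolding P_def using A by (rule measurable_count)
  define n where "n = real (card A)"
  have n: "1 \<le> n" and \<tau>: "\<tau> = n + 1" and bn: "real b \<le> n" "1 \<le> real b" and nonempty: "A \<noteq> {}"
    using b by (auto simp: n_def \<tau>_def)
  have s: "0 \<le> s" "s\<^sup>2 = 2 * ln \<tau> / \<tau>" using n \<tau> by (auto simp: s_def)
  have m: "0 < m" "m < 1" "m = 1 - real b / \<tau>" using n \<tau> bn by (auto simp: m_def field_simps)
  have ratio: "n * (real b / \<tau>) = real b - real b / \<tau>" "real b / \<tau> \<le> 1" "0 \<le> real b / \<tau>"
    using n bn by (auto simp: \<tau> field_simps)
  have tail: "exp (-2 * (n * s)\<^sup>2 / n) \<le> 1 / \<tau>"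
  proof -
    have "1 * ln \<tau> \<le> (4 * n / \<tau>) * ln \<tau>"
      using n \<tau> by (intro mult_right_mono) (auto simp: field_simps)
    moreover have "2 * (n * s)\<^sup>2 / n = (4 * n / \<tau>) * ln \<tau>"
      using n by (simp add: power_mult_distrib s power2_eq_square[of n])
    ultimately have "exp (-2 * (n * s)\<^sup>2 / n) \<le> exp (- ln \<tau>)" by simp
    also have "\<dots> = 1 / \<tau>" using n \<tau> by (simp add: exp_minus field_simps)
    finally show ?thesis .
  qed
  have range: "AE y in P. \<forall>i\<in>A. 0 \<le> fst (y i) \<and> fst (y i) \<le> 1"
    using AE_PiM_support[OF J] A(2) support0_bounds unfolding P_def by (auto elim!: eventually_mono)
  note conc = count_concentration[OF A(1) nonempty A(2), of "n * s", folded P_def n_def]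
  have ns: "0 \<le> n * s" using n s by simp
  show ?few
  proof (cases "m + s \<le> 1")
    case True
    have "n * (1 - (m + s)) + n * s = n * (real b / \<tau>)"
      unfolding m(3) by (simp add: algebra_simps)
    then have "n * measure D0 {quantile0 (m + s)<..} + n * s = real b - real b / \<tau>"
      using True m s ratio(1) by (subst D0_tail) auto
    then have "P.prob {y\<in>space P. b \<le> card {i\<in>A. quantile0 (m + s) < fst (y i)}} \<le>
        P.prob {y\<in>space P. n * measure D0 {quantile0 (m + s)<..} + n * s \<le>
          real (card {i\<in>A. quantile0 (m + s) < fst (y i)})}"
      by (intro P.finite_measure_mono) (use ratio in auto, measurable)
    also have "\<dots> \<le> 1 / \<tau>" using conc(1)[OF ns] tail by (rule order_trans)
    finally show ?thesis .
  next
    case False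
    have "AE y in P. \<not> b \<le> card {i\<in>A. quantile0 (m + s) < fst (y i)}"
      using range
    proof eventually_elim
      case (elim y)
      have "1 < quantile0 (m + s)" using False by (simp add: quantile0_def field_simps)
      then have none: "{i\<in>A. quantile0 (m + s) < fst (y i)} = {}"
        using elim by force
      show ?case unfolding none using b by simp
    qed
    then have "P.prob {y\<in>space P. b \<le> card {i\<in>A. quantile0 (m + s) < fst (y i)}} = 0"
      by (subst P.prob_eq_0) auto
    then show ?thesis using n \<tau> by simp
  qed
  show ?many
  proof (cases "0 \<le> m - s")
    case True
    have "n * (1 - (m - s)) - n * s = n * (real b / \<tau>)"
      unfolding m(3) by (simp add: algebra_simps)
    then have "n * measure D0 {quantile0 (m - s)<..} - n * s = real b - real b / \<tau>"
      using True m s ratio(1) by (subst D0_tail) auto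
    then have "P.prob {y\<in>space P. card {i\<in>A. quantile0 (m - s) < fst (y i)} < b} \<le>
        P.prob {y\<in>space P. real (card {i\<in>A. quantile0 (m - s) < fst (y i)}) \<le>
          n * measure D0 {quantile0 (m - s)<..} - n * s}"
      by (intro P.finite_measure_mono) (use ratio in auto, measurable)
    also have "\<dots> \<le> 1 / \<tau>" using conc(2)[OF ns] tail by (rule order_trans)
    finally show ?thesis .
  next
    case False
    have "AE y in P. \<not> card {i\<in>A. quantile0 (m - s) < fst (y i)} < b"
      using range
    proof eventually_elim
      case (elim y)
      have "quantile0 (m - s) < 0" using False by (simp add: quantile0_def)
      then have all: "{i\<in>A. quantile0 (m - s) < fst (y i)} = A"
        using elim by force
      show ?case unfolding all using b by simp
    qed
    then have "P.prob {y\<in>space P. card {i\<in>A. quantile0 (m - s) < fst (y i)} < b} = 0"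
      by (subst P.prob_eq_0) auto
    then show ?thesis using n \<tau> by simp
  qed
qed

section \<open>The expected loss of a single decision\<close>

lemma expected_step_loss_le_one:
  assumes J: "finite J" "t \<in> J"
  shows "(\<integral>y. step_loss b (J - {t}) p (x y) (\<lambda>i. fst (y i)) t \<partial>PiM J (\<lambda>_. observation)) \<le> 1"
proof (rule prob_space.integral_le_nonneg_const[OF prob_space_PiM_observation])
  show "AE y in PiM J (\<lambda>_. observation). step_loss b (J - {t}) p (x y) (\<lambda>i. fst (y i)) t \<le> 1"
    using AE_PiM_support[OF J(1)] by eventually_elim (use J in \<open>auto intro!: step_loss_le_one\<close>)
qed simp

text \<open>
  The threshold \<open>p\<close> is that of the first phase. If \<open>b\<close> lies between \<open>1\<close> and the number of later
  candidates, then outside two events of probability at most \<open>1 / \<tau>\<close>, the loss is at most \<open>s\<close>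
  and is incurred only when the ability falls into a set of Lebesgue measure at most \<open>2 s\<close>,
  which has probability at most \<open>4 s\<close> because the law has density \<open>2\<close> on its support. The total
  is \<open>2 / \<tau> + 4 s\<^sup>2\<close>. For any other budget the loss is not positive, unless the threshold
  was moved to \<open>1/2\<close>, which then requires \<open>s \<ge> 1/2\<close> and hence \<open>4 s\<^sup>2 \<ge> 1\<close>.

  The level is given as \<open>x y\<close>, only almost surely equal to that of the ability, because the
  draw of the policy takes arbitrary values off the support.
\<close>

lemma expected_step_loss_bound:
  fixes J :: "'i set" and b :: nat
  assumes J: "finite J" "t \<in> J"
    and x: "AE y in PiM J (\<lambda>_. observation). x y = rank0 (fst (y t))"
  defines "A \<equiv> J - {t}" and "\<tau> \<equiv> real (card J)"
  defines "m \<equiv> 1 - real b / \<tau>" and "s \<equiv> sqrt (2 * ln \<tau> / \<tau>)"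
  defines "p \<equiv> (if \<bar>m - 1/2\<bar> \<le> s then 1/2 else m)"
  shows "(\<integral>y. step_loss b A p (x y) (\<lambda>i. fst (y i)) t \<partial>PiM J (\<lambda>_. observation))
    \<le> (2 + 8 * ln \<tau>) / \<tau>" (is "integral\<^sup>L ?P ?loss \<le> _")
proof -
  interpret P: prob_space ?P by (rule prob_space_PiM_observation)
  have A: "finite A" "t \<notin> A" "A \<subseteq> J" "insert t A = J" using J by (auto simp: A_def)
  have \<tau>: "\<tau> = real (card A) + 1"
    unfolding \<tau>_def using A by (metis card_insert_disjoint of_nat_Suc add.commute)
  have \<tau>1: "1 \<le> \<tau>" using \<tau> by simp
  have s: "0 \<le> s" "s\<^sup>2 = 2 * ln \<tau> / \<tau>" using \<tau>1 by (auto simp: s_def)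
  have total: "2 / \<tau> + 4 * s\<^sup>2 = (2 + 8 * ln \<tau>) / \<tau>" using s by (simp add: add_divide_distrib)
  have supp: "AE y in ?P. \<forall>i\<in>insert t A. fst (y i) \<in> support0"
    using AE_PiM_support[OF J(1)] A by simp
  consider "b = 0" | "card A < b" "\<bar>m - 1/2\<bar> \<le> s" | "card A < b" "\<not> \<bar>m - 1/2\<bar> \<le> s"
    | "1 \<le> b" "b \<le> card A" by linarith
  then show ?thesis
  proof cases
    case 1
    have "AE y in ?P. ?loss y \<le> 0"
      using supp by eventually_elim (use A 1 in \<open>auto intro!: step_loss_no_budget\<close>)
    then have "integral\<^sup>L ?P ?loss \<le> 0" by (intro P.integral_le_nonneg_const) auto
    then show ?thesis using \<tau>1 by (smt (verit) divide_nonneg_pos ln_ge_zero)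
  next
    case 2
    \<comment> \<open>The budget exceeds the supply, yet the level \<open>m \<le> 0\<close> counts as close to \<open>1/2\<close>: this forces \<open>s \<ge> 1/2\<close>, and
      the claimed bound is at least the trivial bound \<open>1\<close>.\<close>
    have "m \<le> 0" using 2 \<tau> \<tau>1 by (auto simp: m_def field_simps)
    then have "1/2 \<le> s" using 2 by linarith
    then have "(1/2)\<^sup>2 \<le> s\<^sup>2" by (intro power_mono) auto
    then have "1 \<le> (2 + 8 * ln \<tau>) / \<tau>" unfolding total[symmetric] using \<tau>1
      by (auto simp: power2_eq_square add_increasing)
    then show ?thesis using expected_step_loss_le_one[where b = b and p = p and x = x, OF J] unfolding A_def
      by (rule order_trans[rotated])
  next
    case 3
    have "m \<le> 0" using 3 \<tau> \<tau>1 by (auto simp: m_def field_simps)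
    then have p: "p \<le> 0" using 3 by (simp add: p_def)
    have "AE y in ?P. ?loss y \<le> 0"
      using supp x
    proof eventually_elim
      case (elim y)
      then have "p \<le> x y" using rank0_bounds[of "fst (y t)"] p by simp
      then show ?case using elim A 3 by (intro step_loss_ample_budget) auto
    qed
    then have "integral\<^sup>L ?P ?loss \<le> 0" by (intro P.integral_le_nonneg_const) auto
    then show ?thesis using \<tau>1 by (smt (verit) divide_nonneg_pos ln_ge_zero)
  next
    case 4
    define S where "S = (if \<bar>m - 1/2\<bar> \<le> s then {1/4 - s..1/4} \<union> {3/4..3/4 + s}
      else {quantile0 m - s/2..quantile0 m + s/2})"
    have S: "S \<in> sets borel" by (simp add: S_def)
    have "emeasure lborel S \<le> ennreal (2 * s)"
    proof (cases "\<bar>m - 1/2\<bar> \<le> s")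
      case True
      have "emeasure lborel S \<le> emeasure lborel {1/4 - s..1/4} + emeasure lborel {3/4..3/4 + s}"
        unfolding S_def if_P[OF True] by (rule emeasure_subadditive) auto
      also have "\<dots> = ennreal (2 * s)" using s by (simp flip: ennreal_plus)
      finally show ?thesis .
    next
      case False
      then show ?thesis using s by (auto simp: S_def intro!: ennreal_leI)
    qed
    then have DS: "measure D0 S \<le> 4 * s" using D0_measure_le[OF S, of "2 * s"] s by simp
    define few where "few = {y\<in>space ?P. b \<le> card {i\<in>A. quantile0 (m + s) < fst (y i)}}"
    define many where "many = {y\<in>space ?P. card {i\<in>A. quantile0 (m - s) < fst (y i)} < b}"
    have meas: "few \<in> sets ?P" "many \<in> sets ?P"
      using measurable_count[OF A(1,3)] by (auto simp: few_def many_def)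
    have probs: "P.prob few \<le> 1 / \<tau>" "P.prob many \<le> 1 / \<tau>"
      using count_tails[OF A(1,3) J(1) 4] unfolding few_def many_def m_def s_def \<tau> by auto
    have meas_S: "(\<lambda>y. indicator S (fst (y t)) :: real) \<in> borel_measurable ?P"
      using S J by (intro borel_measurable_indicator') auto
    have int_S: "integrable ?P (\<lambda>y. indicator S (fst (y t)) :: real)"
      using meas_S by (rule P.integrable_const_bound[where B = 1, rotated]) (auto simp: indicator_def)
    have int_few: "integrable ?P (indicat_real few)" and int_many: "integrable ?P (indicat_real many)"
      using meas by (auto intro!: integrable_real_indicator simp: P.emeasure_finite less_top[symmetric])
    \<comment> \<open>The trivial bound \<open>1\<close> is used on the two bad events, the small-loss bound elsewhere.\<close>
    let ?Z = "\<lambda>y. indicator few y + indicator many y + s * indicator S (fst (y t)) :: real"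
    have "integral\<^sup>L ?P ?loss \<le> integral\<^sup>L ?P ?Z"
    proof (rule integral_mono_AE')
      show "AE y in ?P. ?loss y \<le> ?Z y"
        using supp AE_space x
      proof eventually_elim
        case (elim y)
        have in_supp: "\<And>i. i \<in> insert t A \<Longrightarrow> fst (y i) \<in> support0" using elim(1) by blast
        show ?case
        proof (cases "y \<in> few \<union> many")
          case True
          then have "1 \<le> ?Z y" using s by (auto simp: indicator_def)
          then show ?thesis
            using step_loss_le_one[where \<theta> = "\<lambda>i. fst (y i)" and b = b and p = p and x = "x y", OF A(1,2) in_supp]
            by simp
        next
          case False
          then have "card {i\<in>A. quantile0 (m + s) < fst (y i)} < b"
            "b \<le> card {i\<in>A. quantile0 (m - s) < fst (y i)}"
            using elim(2) by (auto simp: few_def many_def)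
          then have "?loss y \<le> s * indicator S (fst (y t))"
            using step_loss_at_gap[where \<theta> = "\<lambda>i. fst (y i)" and m = m and s = s and b = b, OF A(1,2) in_supp]
              step_loss_away_from_gap[where \<theta> = "\<lambda>i. fst (y i)" and m = m and s = s and b = b, OF A(1,2) in_supp]
              s elim(3)
            by (cases "\<bar>m - 1/2\<bar> \<le> s") (simp_all add: p_def S_def)
          then show ?thesis using False by simp
        qed
      qed
    qed (use int_few int_many int_S s in auto)
    also have "\<dots> = P.prob few + P.prob many + s * measure D0 S"
      using meas int_few int_many int_S integral_indicator_component[OF J(2) S]
      by (simp add: Int_absorb2 sets.sets_into_space)
    also have "\<dots> \<le> 1 / \<tau> + 1 / \<tau> + s * (4 * s)"
      using probs DS s by (intro add_mono mult_left_mono) auto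
    also have "\<dots> = (2 + 8 * ln \<tau>) / \<tau>" unfolding total[symmetric] by (simp add: power2_eq_square)
    finally show ?thesis .
  qed
qed

section \<open>Telescoping the regret along the policy\<close>

abbreviation budget :: "nat \<Rightarrow> nat \<Rightarrow> (nat \<Rightarrow> real \<times> real) \<Rightarrow> nat \<Rightarrow> nat" where
  "budget B T \<omega> \<equiv> cwg_remaining F0 {1/2} (1/2) B T (\<lambda>t. fst (\<omega> t)) (\<lambda>t. snd (\<omega> t))"

definition threshold :: "nat \<Rightarrow> nat \<Rightarrow> (nat \<Rightarrow> real \<times> real) \<Rightarrow> nat \<Rightarrow> real" where
  "threshold B T \<omega> t = (if t \<le> phase_end (1/2) T then p_CwG {1/2} T t (budget B T \<omega> (t - 1))
     else p_CE T (phase_end (1/2) T + 1) (budget B T \<omega> (phase_end (1/2) T)))"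

definition draw :: "(nat \<Rightarrow> real \<times> real) \<Rightarrow> nat \<Rightarrow> real" where
  "draw \<omega> t = uniform_draw (quantile_set F0 (fst (\<omega> t))) (snd (\<omega> t))"

lemma budget_Suc:
  "budget B T \<omega> (Suc k) = (if threshold B T \<omega> (Suc k) \<le> draw \<omega> (Suc k) \<and> 0 < budget B T \<omega> k
     then budget B T \<omega> k - 1 else budget B T \<omega> k)"
  by (simp add: Let_def threshold_def draw_def)

lemma budget_cong:
  assumes "\<And>s. s \<in> {1..k} \<Longrightarrow> \<omega> s = \<omega>' s"
  shows "budget B T \<omega> k = budget B T \<omega>' k"
  using assms by (intro cwg_remaining_cong) auto

lemma threshold_cong:
  assumes "\<And>s. s \<in> {1..k} \<Longrightarrow> \<omega> s = \<omega>' s"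
  shows "threshold B T \<omega> (Suc k) = threshold B T \<omega>' (Suc k)"
  unfolding threshold_def using budget_cong[of k \<omega> \<omega>'] budget_cong[of "phase_end (1/2) T" \<omega> \<omega>'] assms
  by auto

lemma measurable_draw [measurable]:
  "t \<in> J \<Longrightarrow> (\<lambda>\<omega>. draw \<omega> t) \<in> borel_measurable (PiM J (\<lambda>_. observation))"
  unfolding draw_def uniform_draw_F0_cases by measurable

text \<open>
  The induction is over all smaller times, because in the second phase the threshold refers back
  to the budget at the end of the first one.
\<close>

lemma measurable_budget:
  assumes "{1..k} \<subseteq> J"
  shows "(\<lambda>\<omega>. budget B T \<omega> k) \<in> measurable (PiM J (\<lambda>_. observation)) (count_space UNIV)"
  using assms
proof (induction k rule: less_induct)
  case (less k)
  show ?case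
  proof (cases k)
    case 0
    then show ?thesis by simp
  next
    case (Suc j)
    let ?M = "PiM J (\<lambda>_. observation)"
    have j: "(\<lambda>\<omega>. budget B T \<omega> j) \<in> measurable ?M (count_space UNIV)"
      by (rule less.IH) (use less.prems Suc in \<open>auto simp: subset_eq\<close>)
    have draw: "(\<lambda>\<omega>. draw \<omega> (Suc j)) \<in> borel_measurable ?M"
      using less.prems Suc by (intro measurable_draw) auto
    have threshold: "(\<lambda>\<omega>. threshold B T \<omega> (Suc j)) \<in> borel_measurable ?M"
    proof (cases "Suc j \<le> phase_end (1/2) T")
      case True
      have "(\<lambda>\<omega>. p_CwG {1/2} T (Suc j) (budget B T \<omega> j)) \<in> borel_measurable ?M"
        by (rule measurable_compose[OF j]) simp
      then show ?thesis using True by (simp add: threshold_def)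
    next
      case False
      then have "(\<lambda>\<omega>. budget B T \<omega> (phase_end (1/2) T)) \<in> measurable ?M (count_space UNIV)"
        by (intro less.IH) (use less.prems Suc in \<open>auto simp: subset_eq\<close>)
      then have "(\<lambda>\<omega>. p_CE T (phase_end (1/2) T + 1) (budget B T \<omega> (phase_end (1/2) T))) \<in>
          borel_measurable ?M"
        by (rule measurable_compose) simp
      then show ?thesis using False by (simp add: threshold_def)
    qed
    have "Measurable.pred ?M (\<lambda>\<omega>. 0 < budget B T \<omega> j)"
      by (rule measurable_compose[OF j]) simp
    then have "{\<omega>\<in>space ?M. threshold B T \<omega> (Suc j) \<le> draw \<omega> (Suc j) \<and> 0 < budget B T \<omega> j} \<in> sets ?M"
      using borel_measurable_le[OF threshold draw]
      by (intro sets.sets_Collect_conj) (simp_all add: pred_def)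
    moreover have "(\<lambda>\<omega>. budget B T \<omega> j - 1) \<in> measurable ?M (count_space UNIV)"
      by (rule measurable_compose[OF j]) simp
    ultimately show ?thesis unfolding Suc budget_Suc using j by (intro measurable_If)
  qed
qed

text \<open>
  The value obtained by following the policy up to time \<open>k\<close> and selecting optimally in hindsight
  afterwards. It interpolates between the hindsight optimum (\<open>k = 0\<close>) and the policy
  (\<open>k = T\<close>).
\<close>

definition hybrid :: "nat \<Rightarrow> nat \<Rightarrow> (nat \<Rightarrow> real \<times> real) \<Rightarrow> nat \<Rightarrow> real" where
  "hybrid B T \<omega> k =
     (\<Sum>t=1..k. fst (\<omega> t) * real (cwg F0 {1/2} (1/2) B T (\<lambda>t. fst (\<omega> t)) (\<lambda>t. snd (\<omega> t)) t)) +
     best_sum (budget B T \<omega> k) {k<..T} (\<lambda>t. fst (\<omega> t))"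

lemma hybrid_step:
  assumes "k < T"
  shows "hybrid B T \<omega> k - hybrid B T \<omega> (Suc k) =
    step_loss (budget B T \<omega> k) {Suc k<..T} (threshold B T \<omega> (Suc k)) (draw \<omega> (Suc k))
      (\<lambda>t. fst (\<omega> t)) (Suc k)"
proof -
  have "insert (Suc k) {Suc k<..T} = {k<..T}" using assms by auto
  then show ?thesis
    unfolding hybrid_def step_loss_def cwg_def
    by (simp add: budget_Suc del: cwg_remaining.simps(2))
qed

lemma integrable_hybrid:
  assumes "k \<le> T"
  shows "integrable (PiM {1..T} (\<lambda>_. observation)) (\<lambda>\<omega>. hybrid B T \<omega> k)"
proof -
  let ?P = "PiM {1..T} (\<lambda>_. observation)"
  interpret P: prob_space ?P by (rule prob_space_PiM_observation)
  have "(\<lambda>\<omega>. best_sum (budget B T \<omega> k) {k<..T} (\<lambda>t. fst (\<omega> t))) \<in> borel_measurable ?P"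
  proof (rule measurable_compose_countable[where f = "\<lambda>b \<omega>. best_sum b {k<..T} (\<lambda>t. fst (\<omega> t))"])
    show "(\<lambda>\<omega>. best_sum b {k<..T} (\<lambda>t. fst (\<omega> t))) \<in> borel_measurable ?P" for b
      by (rule borel_measurable_best_sum) (auto intro!: measurable_fst_component)
    show "(\<lambda>\<omega>. budget B T \<omega> k) \<in> measurable ?P (count_space UNIV)"
      using assms by (intro measurable_budget) auto
  qed
  moreover have "(\<lambda>\<omega>. \<Sum>t=1..k. fst (\<omega> t) *
      real (cwg F0 {1/2} (1/2) B T (\<lambda>t. fst (\<omega> t)) (\<lambda>t. snd (\<omega> t)) t)) \<in> borel_measurable ?P"
  proof (intro borel_measurable_sum borel_measurable_times)
    fix t assume t: "t \<in> {1..k}"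
    show "(\<lambda>\<omega>. fst (\<omega> t)) \<in> borel_measurable ?P" using t assms by (intro measurable_fst_component) auto
    have 1: "(\<lambda>\<omega>. budget B T \<omega> (t - 1)) \<in> measurable ?P (count_space UNIV)"
      and 2: "(\<lambda>\<omega>. budget B T \<omega> t) \<in> measurable ?P (count_space UNIV)"
      using t assms by (auto intro!: measurable_budget)
    show "(\<lambda>\<omega>. real (cwg F0 {1/2} (1/2) B T (\<lambda>t. fst (\<omega> t)) (\<lambda>t. snd (\<omega> t)) t)) \<in> borel_measurable ?P"
      unfolding cwg_def using 1 2 by measurable
  qed
  ultimately have "(\<lambda>\<omega>. hybrid B T \<omega> k) \<in> borel_measurable ?P" unfolding hybrid_def by simp
  moreover have "AE \<omega> in ?P. norm (hybrid B T \<omega> k) \<le> 2 * real T"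
    using AE_PiM_support[of "{1..T}", OF finite_atLeastAtMost]
  proof eventually_elim
    case (elim \<omega>)
    let ?a = "cwg F0 {1/2} (1/2) B T (\<lambda>t. fst (\<omega> t)) (\<lambda>t. snd (\<omega> t))"
    have act: "?a t \<in> {0, 1}" if "t \<in> {1..k}" for t
      using admissible_cwg[of B T F0 "{1/2}" "1/2"] that assms unfolding admissible_def by auto
    have fst: "0 \<le> fst (\<omega> t) \<and> fst (\<omega> t) \<le> 1" if "t \<in> {1..T}" for t
      using elim that support0_bounds by blast
    have "fst (\<omega> t) * real (?a t) \<in> {0..1}" if "t \<in> {1..k}" for t
      using act[OF that] fst[of t] that assms by auto
    then have "(\<Sum>t=1..k. fst (\<omega> t) * real (?a t)) \<in> {0..(\<Sum>t=1..k. 1)}"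
      by (auto intro!: sum_nonneg sum_mono simp del: sum_constant)
    moreover have "best_sum (budget B T \<omega> k) {k<..T} (\<lambda>t. fst (\<omega> t)) \<in> {0..real (card {k<..T})}"
      using fst by (intro best_sum_bounds) auto
    ultimately show ?case using assms unfolding hybrid_def by auto
  qed
  ultimately show ?thesis by (rule P.integrable_const_bound[rotated])
qed

text \<open>
  For \<open>\<epsilon>0 = 1/2\<close> the second phase has length at most \<open>\<lfloor>256 * ln 2\<rfloor>\<close>, a constant between \<open>1\<close>
  and \<open>256\<close>.
\<close>

lemma phase_end_half_bounds:
  "T - 256 \<le> phase_end (1/2) T" "phase_end (1/2) T \<le> T - 1"
proof -
  define z where "z = \<lfloor>256 * ln (2::real)\<rfloor>"
  have "1 \<le> z" using ln2_ge_two_thirds by (simp add: z_def le_floor_iff)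
  moreover have "z \<le> 256" using ln_2_less_1 by (simp add: z_def floor_le_iff)
  moreover have "phase_end (1/2) T = nat (max 0 (int T - z))"
    by (simp add: phase_end_def z_def power2_eq_square)
  ultimately show "T - 256 \<le> phase_end (1/2) T" "phase_end (1/2) T \<le> T - 1" by auto
qed

lemma p_CwG_half:
  "p_CwG {1/2} T t b = (let m = p_CE T t b in
     if \<bar>m - 1/2\<bar> \<le> sqrt (2 * ln (real T - real t + 1) / (real T - real t + 1)) then 1/2 else m)"
proof -
  have "arg_min_on f {x} = x" for f :: "real \<Rightarrow> real" and x
    unfolding arg_min_on_def arg_min_def is_arg_min_def by (rule some_equality) auto
  moreover have "nearby_gaps {1/2} T t b = (if \<bar>p_CE T t b - 1/2\<bar> \<le>
      sqrt (2 * ln (real T - real t + 1) / (real T - real t + 1)) then {1/2} else {})"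
    unfolding nearby_gaps_def by auto
  ultimately show ?thesis by (simp add: p_CwG_def Let_def)
qed

text \<open>
  Conditionally on the first \<open>k\<close> observations the budget and the threshold are constants, and
  the bounds for fixed \<open>b\<close> and \<open>p\<close> apply to every value they may take. In the second phase the
  trivial bound \<open>1\<close> suffices, as then \<open>T - k \<le> 256\<close>.
\<close>

lemma expected_hybrid_step:
  assumes "k < T"
  shows "(\<integral>\<omega>. hybrid B T \<omega> k - hybrid B T \<omega> (Suc k) \<partial>PiM {1..T} (\<lambda>_. observation))
    \<le> 256 * (1 + ln (real (T - k))) / real (T - k)"
proof -
  define I J where "I = {1..k}" and "J = {Suc k..T}"
  define \<tau> where "\<tau> = real (T - k)"
  have IJ: "I \<inter> J = {}" "I \<union> J = {1..T}" "finite I" "finite J" "Suc k \<in> J" "card J = T - k"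
      "J - {Suc k} = {Suc k<..T}"
    using assms by (auto simp: I_def J_def)
  have \<tau>: "1 \<le> \<tau>" "\<tau> = real T - real (Suc k) + 1" using assms by (auto simp: \<tau>_def)
  let ?O = "\<lambda>_::nat. observation"
  let ?f = "\<lambda>\<omega>. hybrid B T \<omega> k - hybrid B T \<omega> (Suc k)"
  interpret product_sigma_finite ?O
    by (simp add: product_sigma_finite_def observation.sigma_finite_measure_axioms)
  have inner: "(\<integral>y. ?f (merge I J (x, y)) \<partial>PiM J ?O) \<le> 256 * (1 + ln \<tau>) / \<tau>" for x
  proof -
    define b where "b = budget B T x k"
    define p where "p = threshold B T x (Suc k)"
    have "?f (merge I J (x, y)) = step_loss b {Suc k<..T} p (draw y (Suc k)) (\<lambda>t. fst (y t)) (Suc k)" for y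
    proof -
      let ?\<omega> = "merge I J (x, y)"
      have past: "?\<omega> i = x i" if "i \<in> {1..k}" for i using that by (simp add: merge_def I_def)
      have future: "?\<omega> i = y i" if "i \<in> {k<..T}" for i using that by (simp add: merge_def I_def J_def)
      have "budget B T ?\<omega> k = b" unfolding b_def using past by (rule budget_cong)
      moreover have "threshold B T ?\<omega> (Suc k) = p" unfolding p_def using past by (rule threshold_cong)
      moreover have "best_sum c A (\<lambda>t. fst (?\<omega> t)) = best_sum c A (\<lambda>t. fst (y t))"
        if "A \<subseteq> {k<..T}" for c A
        using that future by (intro best_sum_cong) auto
      moreover have "insert (Suc k) {Suc k<..T} \<subseteq> {k<..T}" "{Suc k<..T} \<subseteq> {k<..T}"
        using assms by auto
      moreover have "?\<omega> (Suc k) = y (Suc k)" using future assms by simp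
      ultimately show ?thesis
        unfolding hybrid_step[OF assms] step_loss_def draw_def by simp
    qed
    then have "(\<integral>y. ?f (merge I J (x, y)) \<partial>PiM J ?O) =
        (\<integral>y. step_loss b {Suc k<..T} p (draw y (Suc k)) (\<lambda>t. fst (y t)) (Suc k) \<partial>PiM J ?O)" by simp
    also have "\<dots> \<le> 256 * (1 + ln \<tau>) / \<tau>"
    proof (cases "Suc k \<le> phase_end (1/2) T")
      case False
      then have "\<tau> \<le> 256" using phase_end_half_bounds(1)[of T] by (simp add: \<tau>_def)
      then have "1 \<le> 256 * (1 + ln \<tau>) / \<tau>" using \<tau> by (simp add: add_increasing2)
      then show ?thesis
        using expected_step_loss_le_one[where b = b and p = p and x = "\<lambda>y. draw y (Suc k)", OF IJ(4,5)] IJ(7) by simp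
    next
      case True
      have p: "p = (if \<bar>1 - real b / \<tau> - 1/2\<bar> \<le> sqrt (2 * ln \<tau> / \<tau>) then 1/2 else 1 - real b / \<tau>)"
        using True by (simp add: p_def threshold_def p_CwG_half b_def p_CE_def \<tau>(2) Let_def)
      have "AE y in PiM J ?O. draw y (Suc k) = rank0 (fst (y (Suc k)))"
        using AE_PiM_support[OF IJ(4)] by eventually_elim (use IJ(5) in \<open>simp add: draw_def uniform_draw_F0\<close>)
      then have "(\<integral>y. step_loss b {Suc k<..T} p (draw y (Suc k)) (\<lambda>t. fst (y t)) (Suc k) \<partial>PiM J ?O)
          \<le> (2 + 8 * ln \<tau>) / \<tau>"
        using expected_step_loss_bound[where x = "\<lambda>y. draw y (Suc k)" and b = b, OF IJ(4,5)]
        unfolding IJ(6,7) \<tau>_def[symmetric] p by simp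
      also have "\<dots> \<le> 256 * (1 + ln \<tau>) / \<tau>"
        using \<tau>(1) by (intro divide_right_mono) auto
      finally show ?thesis .
    qed
    finally show ?thesis .
  qed
  have "(\<integral>\<omega>. ?f \<omega> \<partial>PiM {1..T} ?O) = (\<integral>x. \<integral>y. ?f (merge I J (x, y)) \<partial>PiM J ?O \<partial>PiM I ?O)"
    using product_integral_fold[of I J ?f] IJ integrable_hybrid assms by simp
  also have "\<dots> \<le> 256 * (1 + ln \<tau>) / \<tau>"
    using inner \<tau> by (intro prob_space.integral_le_nonneg_const[OF prob_space_PiM_observation]) auto
  finally show ?thesis by (simp add: \<tau>_def)
qed

lemma regret_eq_sum:
  "regret D0 B T (cwg F0 {1/2} (1/2) B T) =
     (\<Sum>k<T. \<integral>\<omega>. hybrid B T \<omega> k - hybrid B T \<omega> (Suc k) \<partial>PiM {1..T} (\<lambda>_. observation))"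
proof -
  let ?P = "PiM {1..T} (\<lambda>_. observation)"
  have "hindsight B T (\<lambda>t. fst (\<omega> t)) = hybrid B T \<omega> 0" for \<omega>
    by (simp add: hindsight_eq_best_sum hybrid_def atLeastSucAtMost_greaterThanAtMost[symmetric])
  moreover have "(\<Sum>t=1..T. fst (\<omega> t) * real (cwg F0 {1/2} (1/2) B T (\<lambda>t. fst (\<omega> t)) (\<lambda>t. snd (\<omega> t)) t))
      = hybrid B T \<omega> T" for \<omega>
    by (simp add: hybrid_def)
  ultimately have "regret D0 B T (cwg F0 {1/2} (1/2) B T) =
      (\<integral>\<omega>. hybrid B T \<omega> 0 \<partial>?P) - (\<integral>\<omega>. hybrid B T \<omega> T \<partial>?P)"
    by (simp add: regret_def sample_space_def)
  also have "\<dots> = (\<Sum>k<T. (\<integral>\<omega>. hybrid B T \<omega> k \<partial>?P) - (\<integral>\<omega>. hybrid B T \<omega> (Suc k) \<partial>?P))"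
    by (rule sum_lessThan_telescope'[symmetric])
  also have "\<dots> = (\<Sum>k<T. \<integral>\<omega>. hybrid B T \<omega> k - hybrid B T \<omega> (Suc k) \<partial>?P)"
    by (intro sum.cong refl Bochner_Integration.integral_diff[symmetric] integrable_hybrid) auto
  finally show ?thesis .
qed

lemma regret_le:
  assumes "1 \<le> T"
  shows "regret D0 B T (cwg F0 {1/2} (1/2) B T) \<le> 256 * (1 + ln (real T))\<^sup>2"
proof -
  have T: "0 \<le> ln (real T)" using assms by simp
  have "regret D0 B T (cwg F0 {1/2} (1/2) B T) \<le> (\<Sum>k<T. 256 * (1 + ln (real (T - k))) / real (T - k))"
    unfolding regret_eq_sum by (intro sum_mono expected_hybrid_step) simp
  also have "\<dots> \<le> (\<Sum>k<T. 256 * (1 + ln (real T)) * inverse (real (T - k)))"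
    by (intro sum_mono) (auto simp: divide_inverse intro!: mult_right_mono)
  also have "\<dots> = 256 * (1 + ln (real T)) * (\<Sum>k<T. inverse (real (Suc (T - Suc k))))"
    by (simp add: sum_distrib_left Suc_diff_Suc)
  also have "(\<Sum>k<T. inverse (real (Suc (T - Suc k)))) = harm T"
    unfolding sum.nat_diff_reindex[of "\<lambda>j. inverse (real (Suc j))"] harm_def
    by (simp add: sum.atLeast1_atMost_eq)
  also have "256 * (1 + ln (real T)) * harm T \<le> 256 * (1 + ln (real T)) * (1 + ln (real T))"
    using T euler_mascheroni_sequence_decreasing[of 1 T] assms
    by (intro mult_left_mono) (simp_all add: harm_def)
  finally show ?thesis by (simp only: power2_eq_square mult.assoc)
qed

text \<open>
  The case \<open>T = 1\<close> has to be treated exactly, since the bound \<open>C * (ln 1)\<^sup>2\<close> vanishes: the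
  threshold is \<open>0\<close> and the single candidate is hired almost surely.
\<close>

lemma regret_horizon_one: "regret D0 1 1 (cwg F0 {1/2} (1/2) 1 1) \<le> 0"
proof -
  have no_phase1: "phase_end (1/2) (Suc 0) = 0" using phase_end_half_bounds(2)[of 1] by simp
  have "AE \<omega> in PiM {1..1::nat} (\<lambda>_. observation). hybrid 1 1 \<omega> 0 - hybrid 1 1 \<omega> (Suc 0) \<le> 0"
    using AE_PiM_support[of "{1..1::nat}", OF finite_atLeastAtMost]
  proof eventually_elim
    case (elim \<omega>)
    then have supp: "fst (\<omega> 1) \<in> support0" by simp
    then have "threshold 1 1 \<omega> 1 \<le> draw \<omega> 1"
      using rank0_bounds by (simp add: threshold_def no_phase1 p_CE_def draw_def uniform_draw_F0)
    then show ?case using supp unfolding hybrid_step[OF zero_less_one]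
      by (intro step_loss_ample_budget) auto
  qed
  then have "(\<integral>\<omega>. hybrid 1 1 \<omega> 0 - hybrid 1 1 \<omega> (Suc 0) \<partial>PiM {1..1} (\<lambda>_. observation)) \<le> 0"
    by (rule prob_space.integral_le_nonneg_const[OF prob_space_PiM_observation]) simp
  then show ?thesis unfolding regret_eq_sum by simp
qed

theorem corollary1:
  shows "\<exists>C::real. \<forall>T::nat. \<forall>B\<in>{1..T}.
           regret D0 B T (cwg F0 {1/2} (1/2) B T) \<le> C * (ln (real T))\<^sup>2"
proof (intro exI allI ballI)
  fix T B :: nat assume B: "B \<in> {1..T}"
  show "regret D0 B T (cwg F0 {1/2} (1/2) B T) \<le> 2304 * (ln (real T))\<^sup>2"
  proof (cases "T = 1")
    case True
    then show ?thesis using B regret_horizon_one by simp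
  next
    case False
    then have T: "2 \<le> T" using B by simp
    have "ln 2 \<le> ln (real T)" using T by simp
    then have "1 + ln (real T) \<le> 3 * ln (real T)" using ln2_ge_two_thirds by simp
    moreover have "0 \<le> 1 + ln (real T)" using T by (simp add: add_increasing)
    ultimately have "(1 + ln (real T))\<^sup>2 \<le> (3 * ln (real T))\<^sup>2" by (rule power_mono)
    then show ?thesis using regret_le[of T B] T by (simp add: power_mult_distrib)
  qed
qed

end
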